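(* For all positive integers $n$ and $m$, an $n$-controlled $m$-target Toffoli gate $C^n\bigotimes_{i=1}^m X_i$ can be constructed as a quantum circuit using one clean ancilla qubit, with a total of $6n+2m$ CNOT gates (together with single-qubit gates) and a depth of $\mathcal{O}(\log n+\log m)$.
   Context: Circuits are built from arbitrary single-qubit unitary gates and CNOT gates (between arbitrary pairs of qubits). The CNOT count is the number of CNOT gates used. The depth is the minimal number of layers into which the gates can be arranged so that gates in the same layer act on disjoint qubits. The bound $\mathcal{O}(\log n+\log m)$ is with an absolute constant and is understood up to an additive constant, i.e. depth $\le C(1+\log n+\log m)$. The $n$-controlled $m$-target Toffoli gate $C^n\bigotimes_{i=1}^m X_i$ has $n$ control qubits and $m$ target qubits: it applies $X=\sigma_x$ to every one of the $m$ targets if all $n$ controls are in state $|1\rangle$, and acts as the identity on the computational basis states for which some control is $|0\rangle$. A clean ancilla is an additional qubit, initialized in $|0\rangle$ and returned to $|0\rangle$ at the end of the circuit; so a circuit $V$ on $n+m+1$ qubits implements a gate $G$ on $n+m$ qubits with one clean ancilla if $V(|\psi\rangle\otimes|0\rangle)=(G|\psi\rangle)\otimes|0\rangle$ for every state $|\psi\rangle$ of the $n+m$ qubits. *)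

theory Defs
  imports
    Complex_Main
    "Jordan_Normal_Form.Matrix"
    "Jordan_Normal_Form.Schur_Decomposition"
begin

text \<open>
  The state space of \<open>N\<close> qubits, numbered \<open>0, \<dots>, N - 1\<close>, is \<open>carrier_vec (2 ^ N)\<close> over the complex
  numbers.  The computational basis vector with index \<open>x < 2 ^ N\<close> is the one in which qubit \<open>q\<close>
  has the value \<open>bit x q\<close>; thus qubit 0 is the least significant bit of the index.
\<close>

definition pure_state :: "nat \<Rightarrow> complex vec \<Rightarrow> bool" where
  "pure_state N \<psi> \<longleftrightarrow> \<psi> \<in> carrier_vec (2 ^ N) \<and> \<psi> \<bullet>c \<psi> = 1"

text \<open>
  With the least significant qubit first, the qubits of the left factor of a tensor product keep
  their numbers and those of the right factor follow them.
\<close>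

definition tensor_vec :: "complex vec \<Rightarrow> complex vec \<Rightarrow> complex vec" where
  "tensor_vec u v =
     vec (dim_vec u * dim_vec v) (\<lambda>x. u $ (x mod dim_vec u) * v $ (x div dim_vec u))"

definition ket0 :: "complex vec" where
  "ket0 = unit_vec 2 0"

definition unitary_mat :: "nat \<Rightarrow> complex mat \<Rightarrow> bool" where
  "unitary_mat d U \<longleftrightarrow> U \<in> carrier_mat d d \<and> mat_adjoint U * U = 1\<^sub>m d"

text \<open>The linear map on \<open>N\<close> qubits that sends the basis state \<open>x\<close> to the basis state \<open>f x\<close>.\<close>

definition basis_map_mat :: "nat \<Rightarrow> (nat \<Rightarrow> nat) \<Rightarrow> complex mat" where
  "basis_map_mat N f = mat (2 ^ N) (2 ^ N) (\<lambda>(y, x). if y = f x then 1 else 0)"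

datatype gate =
    Single "complex mat" nat
  | CNOT (control: nat) (target: nat)

type_synonym circuit = "gate list"

fun gate_qubits :: "gate \<Rightarrow> nat set" where
  "gate_qubits (Single U q) = {q}"
| "gate_qubits (CNOT c t) = {c, t}"

fun valid_gate :: "nat \<Rightarrow> gate \<Rightarrow> bool" where
  "valid_gate N (Single U q) \<longleftrightarrow> q < N \<and> unitary_mat 2 U"
| "valid_gate N (CNOT c t) \<longleftrightarrow> c < N \<and> t < N \<and> c \<noteq> t"

definition valid_circuit :: "nat \<Rightarrow> circuit \<Rightarrow> bool" where
  "valid_circuit N gs \<longleftrightarrow> (\<forall>g \<in> set gs. valid_gate N g)"

text \<open>
  A single-qubit gate \<open>U\<close> on qubit \<open>q\<close> is \<open>U\<close> tensored with the identity on all other qubits: an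
  entry is nonzero only if the row and column indices agree outside bit \<open>q\<close>.
\<close>

fun gate_mat :: "nat \<Rightarrow> gate \<Rightarrow> complex mat" where
  "gate_mat N (Single U q) =
     mat (2 ^ N) (2 ^ N) (\<lambda>(y, x).
       if unset_bit q y = unset_bit q x
       then U $$ (of_bool (bit y q), of_bool (bit x q)) else 0)"
| "gate_mat N (CNOT c t) =
     basis_map_mat N (\<lambda>x. if bit x c then flip_bit t x else x)"

text \<open>The head of the list is the gate that is applied first.\<close>

fun circuit_mat :: "nat \<Rightarrow> circuit \<Rightarrow> complex mat" where
  "circuit_mat N [] = 1\<^sub>m (2 ^ N)"
| "circuit_mat N (g # gs) = circuit_mat N gs * gate_mat N g"

fun is_CNOT :: "gate \<Rightarrow> bool" where
  "is_CNOT (Single U q) = False"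
| "is_CNOT (CNOT c t) = True"

definition cnot_count :: "circuit \<Rightarrow> nat" where
  "cnot_count gs = length (filter is_CNOT gs)"

text \<open>
  An arrangement of the gates into layers \<open>0, \<dots>, d - 1\<close>.  Gates that share a qubit lie in
  different layers, in the order in which the circuit applies them.
\<close>

definition layering :: "circuit \<Rightarrow> nat \<Rightarrow> (nat \<Rightarrow> nat) \<Rightarrow> bool" where
  "layering gs d l \<longleftrightarrow>
     (\<forall>i < length gs. l i < d) \<and>
     (\<forall>i j. i < j \<and> j < length gs \<and> gate_qubits (gs ! i) \<inter> gate_qubits (gs ! j) \<noteq> {}
        \<longrightarrow> l i < l j)"

definition depth :: "circuit \<Rightarrow> nat" where
  "depth gs = (LEAST d. \<exists>l. layering gs d l)"

text \<open>
  The controls are the qubits \<open>0, \<dots>, n - 1\<close> and the targets are the qubits \<open>n, \<dots>, n + m - 1\<close>.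
\<close>

definition toffoli_mat :: "nat \<Rightarrow> nat \<Rightarrow> complex mat" where
  "toffoli_mat n m =
     basis_map_mat (n + m)
       (\<lambda>x. if \<forall>c < n. bit x c then fold flip_bit [n..<n + m] x else x)"

text \<open>The ancilla is the last qubit, with number \<open>N\<close>.\<close>

definition implements_with_clean_ancilla :: "nat \<Rightarrow> circuit \<Rightarrow> complex mat \<Rightarrow> bool" where
  "implements_with_clean_ancilla N gs G \<longleftrightarrow>
     valid_circuit (N + 1) gs \<and>
     (\<forall>\<psi>. pure_state N \<psi> \<longrightarrow>
        circuit_mat (N + 1) gs *\<^sub>v tensor_vec \<psi> ket0 = tensor_vec (G *\<^sub>v \<psi>) ket0)"

end

theory Submission
  imports Defs
begin

text \<open>
  The AND of the controls is computed by a network of Margolus gates, which are Toffoli gates up to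
  a sign and cost only 3 CNOTs.  The network is undone after its result has been used, so that the
  signs cancel.  It needs scratch qubits, and it makes its own: once \<open>z\<close> holds the AND of \<open>u\<close> and \<open>v\<close>,
  applying X to \<open>u\<close> and \<open>v\<close> leaves both in state 0 provided that \<open>z\<close> is 1.  When \<open>z\<close> is 0 these qubits
  are not clean, but then the final AND must be 0 anyway, and it is if \<open>z\<close> is among its inputs.
  A block with 7 clean qubits splits its controls into halves that are treated in
  parallel with 3 clean qubits each, and a block with fewer than 7 gains one by absorbing 3 controls;
  so the depth is logarithmic.  With the ancilla as the first \<open>z\<close> there remain three qubits whose AND
  controls the target.  That costs 18 CNOTs, and the \<open>n - 3\<close> nodes, computed and uncomputed, cost
  \<open>6 (n - 3)\<close>.  Conjugation with a balanced tree of \<open>m - 1\<close> CNOTs then turns one target into \<open>m\<close>, and two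
  CNOTs that cancel bring the count to \<open>6 n + 2 m\<close>.
\<close>

section \<open>Circuits acting on amplitudes\<close>

text \<open>
  A state is represented by its amplitude function, so the number of qubits disappears and a circuit
  that permutes the basis acts by precomposition with the inverse permutation.
\<close>

fun apply_gate :: "gate \<Rightarrow> (nat \<Rightarrow> complex) \<Rightarrow> nat \<Rightarrow> complex" where
  "apply_gate (Single U q) \<phi> x =
     U $$ (of_bool (bit x q), 0) * \<phi> (unset_bit q x) + U $$ (of_bool (bit x q), 1) * \<phi> (set_bit q x)"
| "apply_gate (CNOT c t) \<phi> x = \<phi> (if bit x c then flip_bit t x else x)"

definition run :: "circuit \<Rightarrow> (nat \<Rightarrow> complex) \<Rightarrow> nat \<Rightarrow> complex" where
  "run gs = fold apply_gate gs"

lemma run_simps [simp]: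
  "run [] \<phi> = \<phi>"
  "run (g # gs) \<phi> = run gs (apply_gate g \<phi>)"
  "run (gs @ hs) \<phi> = run hs (run gs \<phi>)"
  by (simp_all add: run_def)

lemmas bit_upd = bit_flip_bit_iff bit_set_bit_iff bit_unset_bit_iff bit_xor_iff bit_exp_iff

lemma nat_less_exp_iff_bit: "x < 2 ^ N \<longleftrightarrow> (\<forall>q \<ge> N. \<not> bit (x::nat) q)"
proof
  assume "x < 2 ^ N"
  then show "\<forall>q \<ge> N. \<not> bit x q"
    by (metis bit_take_bit_iff linorder_not_le take_bit_nat_eq_self_iff)
next
  assume "\<forall>q \<ge> N. \<not> bit x q"
  then have "take_bit N x = x"
    by (intro bit_eqI) (auto simp: bit_take_bit_iff not_le)
  then show "x < 2 ^ N"
    by (simp add: take_bit_nat_eq_self_iff)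
qed

text \<open>Collapses repeated updates of one qubit, so that short gate lists can be evaluated by
  simplification.\<close>

lemma bit_update_normal:
  fixes x :: nat
  shows "unset_bit q (unset_bit q x) = unset_bit q x" "unset_bit q (set_bit q x) = unset_bit q x"
    "set_bit q (unset_bit q x) = set_bit q x" "set_bit q (set_bit q x) = set_bit q x"
    "flip_bit q (unset_bit q x) = set_bit q x" "flip_bit q (set_bit q x) = unset_bit q x"
    "flip_bit q (flip_bit q x) = x"
    "bit x q \<Longrightarrow> set_bit q x = x" "\<not> bit x q \<Longrightarrow> unset_bit q x = x"
    "bit x q \<Longrightarrow> flip_bit q x = unset_bit q x" "\<not> bit x q \<Longrightarrow> flip_bit q x = set_bit q x"
  by (auto intro!: bit_eqI simp: bit_upd)

text \<open>In row \<open>x\<close> only the indices that agree with \<open>x\<close> outside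
  \<open>q\<close> contribute for a single-qubit gate; a CNOT is an involution, so one index does. A
  valid gate never leads out of the range below \<open>2 ^ N\<close>, so \<open>\<phi>\<close> may
  be arbitrary beyond it.\<close>

lemma gate_mat_apply:
  assumes g: "valid_gate N g" and \<psi>: "\<psi> \<in> carrier_vec (2 ^ N)"
    and eq: "\<And>x. x < 2 ^ N \<Longrightarrow> \<psi> $ x = \<phi> x" and x: "x < 2 ^ N"
  shows "(gate_mat N g *\<^sub>v \<psi>) $ x = apply_gate g \<phi> x"
proof (cases g)
  case (Single U q)
  then have q: "q < N" using g by simp
  have lt: "unset_bit q x < 2 ^ N" "set_bit q x < 2 ^ N"
    using x q unfolding nat_less_exp_iff_bit by (auto simp: bit_upd)
  have ne: "unset_bit q x \<noteq> set_bit q x"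
    by (metis bit_set_bit_iff bit_unset_bit_iff possible_bit_nat)
  have iff: "unset_bit q x = unset_bit q y \<longleftrightarrow> y = unset_bit q x \<or> y = set_bit q x" for y
  proof (cases "bit y q")
    case True
    then have "y = set_bit q (unset_bit q y)" by (simp add: bit_update_normal)
    then show ?thesis using ne by (metis bit_update_normal(1-3))
  next
    case False
    then show ?thesis using ne by (metis bit_update_normal(1,2,9))
  qed
  let ?f = "\<lambda>y. (if unset_bit q x = unset_bit q y
       then U $$ (of_bool (bit x q), of_bool (bit y q)) else 0) * \<psi> $ y"
  have "(gate_mat N g *\<^sub>v \<psi>) $ x = (\<Sum>y<2^N. ?f y)"
    using x \<psi> by (simp add: Single scalar_prod_def atLeast0LessThan)
  also have "\<dots> = (\<Sum>y\<in>{unset_bit q x, set_bit q x}. ?f y)"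
    using lt by (intro sum.mono_neutral_right) (auto simp: iff)
  also have "\<dots> = apply_gate g \<phi> x"
    using ne lt by (simp add: Single bit_update_normal eq bit_upd)
  finally show ?thesis .
next
  case (CNOT c t)
  then have ct: "t < N" "c \<noteq> t" using g by auto
  let ?f = "\<lambda>x::nat. if bit x c then flip_bit t x else x"
  have inv: "x = ?f y \<longleftrightarrow> y = ?f x" for x y
    using ct(2) by (auto simp: bit_upd bit_update_normal)
  have lt: "?f x < 2 ^ N"
    using x ct unfolding nat_less_exp_iff_bit by (auto simp: bit_upd)
  have "(gate_mat N g *\<^sub>v \<psi>) $ x = (\<Sum>y<2^N. (if y = ?f x then 1 else 0) * \<psi> $ y)"
    using x \<psi> by (simp add: CNOT basis_map_mat_def scalar_prod_def atLeast0LessThan inv)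
  also have "\<dots> = (\<Sum>y<2^N. if y = ?f x then \<psi> $ y else 0)"
    by (intro sum.cong) auto
  also have "\<dots> = \<psi> $ ?f x"
    using lt by (subst sum.delta) (auto split: if_splits)
  finally show ?thesis using eq[OF lt] by (simp add: CNOT)
qed

lemma circuit_mat_apply:
  assumes "valid_circuit N gs" "\<psi> \<in> carrier_vec (2 ^ N)"
    "\<And>x. x < 2 ^ N \<Longrightarrow> \<psi> $ x = \<phi> x" "x < 2 ^ N"
  shows "(circuit_mat N gs *\<^sub>v \<psi>) $ x = run gs \<phi> x"
  using assms
proof (induction gs arbitrary: \<psi> \<phi> x)
  case (Cons g gs)
  have car: "gate_mat N h \<in> carrier_mat (2 ^ N) (2 ^ N)" for h
    by (cases h) (auto simp: basis_map_mat_def)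
  have "circuit_mat N hs \<in> carrier_mat (2 ^ N) (2 ^ N)" for hs
    by (induction hs) (auto intro: mult_carrier_mat car)
  then have "circuit_mat N (g # gs) *\<^sub>v \<psi> = circuit_mat N gs *\<^sub>v (gate_mat N g *\<^sub>v \<psi>)"
    using Cons.prems(2) car by (simp add: assoc_mult_mat_vec[of _ "2 ^ N" "2 ^ N" _ "2 ^ N"])
  moreover have "(circuit_mat N gs *\<^sub>v (gate_mat N g *\<^sub>v \<psi>)) $ x = run gs (apply_gate g \<phi>) x"
    using Cons.prems car gate_mat_apply
    by (intro Cons.IH) (auto simp: valid_circuit_def intro!: mult_mat_vec_carrier)
  ultimately show ?case by simp
qed auto

section \<open>Single-qubit gates and their action on amplitudes\<close>

definition mat2 :: "complex \<Rightarrow> complex \<Rightarrow> complex \<Rightarrow> complex \<Rightarrow> complex mat" where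
  "mat2 p q r s = mat 2 2 (\<lambda>(i, j). if i = 0 then (if j = 0 then p else q) else (if j = 0 then r else s))"

lemma unitary_mat2:
  assumes "cnj p * p + cnj r * r = 1" "cnj q * q + cnj s * s = 1" "cnj p * q + cnj r * s = 0"
  shows "unitary_mat 2 (mat2 p q r s)"
proof -
  have "cnj q * p + cnj s * r = 0"
    using arg_cong[OF assms(3), of cnj] by (simp add: mult.commute)
  then show ?thesis
    using assms
    by (auto simp: unitary_mat_def mat2_def mat_adjoint_def scalar_prod_def less_2_cases_iff
        numeral_2_eq_2 mat_of_rows_def intro!: eq_matI)
qed

lemma apply_mat2 [simp]:
  "apply_gate (Single (mat2 p q r s) t) \<phi> x =
     (if bit x t then r * \<phi> (unset_bit t x) + s * \<phi> (set_bit t x)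
      else p * \<phi> (unset_bit t x) + q * \<phi> (set_bit t x))"
  by (simp add: mat2_def)

declare apply_gate.simps(1) [simp del]

definition x_gate :: "nat \<Rightarrow> gate" where
  "x_gate q = Single (mat2 0 1 1 0) q"

lemma apply_x_gate [simp]: "apply_gate (x_gate q) \<phi> x = \<phi> (flip_bit q x)"
  by (auto simp: x_gate_def bit_update_normal)

definition phase_gate :: "complex \<Rightarrow> nat \<Rightarrow> gate" where
  "phase_gate w q = Single (mat2 1 0 0 w) q"

lemma apply_phase_gate [simp]: "apply_gate (phase_gate w q) \<phi> x = (if bit x q then w else 1) * \<phi> x"
  by (auto simp: phase_gate_def bit_update_normal)

text \<open>This is \<open>R_y(2 * \<theta>)\<close> in the usual notation; the angle
  \<open>pi / 8\<close> below gives the \<open>R_y(pi / 4)\<close> of the Margolus gate.\<close>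

definition rot_gate :: "real \<Rightarrow> nat \<Rightarrow> gate" where
  "rot_gate \<theta> q = Single (mat2 (cos \<theta>) (- sin \<theta>) (sin \<theta>) (cos \<theta>)) q"

definition inv_sqrt2 :: complex where
  "inv_sqrt2 = complex_of_real (1 / sqrt 2)"

lemma inv_sqrt2_mult: "inv_sqrt2 * inv_sqrt2 = 1 / 2"
  unfolding inv_sqrt2_def
  by (metis of_real_1 of_real_divide of_real_mult of_real_numeral power2_eq_square
      power_one_over real_sqrt_pow2 zero_le_numeral)

definition had_gate :: "nat \<Rightarrow> gate" where
  "had_gate q = Single (mat2 inv_sqrt2 inv_sqrt2 inv_sqrt2 (- inv_sqrt2)) q"

lemma valid_named_gates [simp]:
  "q < N \<Longrightarrow> valid_gate N (x_gate q)"
  "q < N \<Longrightarrow> cmod w = 1 \<Longrightarrow> valid_gate N (phase_gate w q)"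
  "q < N \<Longrightarrow> valid_gate N (rot_gate \<theta> q)"
  "q < N \<Longrightarrow> valid_gate N (had_gate q)"
proof -
  have "complex_of_real (cos \<theta>) * complex_of_real (cos \<theta>) + complex_of_real (sin \<theta>) * complex_of_real (sin \<theta>) = 1"
    by (metis of_real_1 of_real_add of_real_mult power2_eq_square sin_cos_squared_add2)
  then show "q < N \<Longrightarrow> valid_gate N (rot_gate \<theta> q)"
    by (auto simp: rot_gate_def add.commute intro!: unitary_mat2)
  have "cnj inv_sqrt2 = inv_sqrt2"
    by (simp add: inv_sqrt2_def)
  then show "q < N \<Longrightarrow> valid_gate N (had_gate q)"
    by (auto simp: had_gate_def inv_sqrt2_mult intro!: unitary_mat2)
  show "q < N \<Longrightarrow> cmod w = 1 \<Longrightarrow> valid_gate N (phase_gate w q)"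
    by (auto simp: phase_gate_def complex_norm_square[symmetric] mult.commute[of "cnj w"] intro!: unitary_mat2)
qed (auto simp: x_gate_def intro!: unitary_mat2)

lemma named_gates_structure [simp]:
  "gate_qubits (x_gate q) = {q}" "gate_qubits (phase_gate w q) = {q}"
  "gate_qubits (rot_gate \<theta> q) = {q}" "gate_qubits (had_gate q) = {q}"
  "\<not> is_CNOT (x_gate q)" "\<not> is_CNOT (phase_gate w q)"
  "\<not> is_CNOT (rot_gate \<theta> q)" "\<not> is_CNOT (had_gate q)"
  by (simp_all add: x_gate_def phase_gate_def rot_gate_def had_gate_def)

section \<open>The Margolus gate and the exact Toffoli gate\<close>

definition margolus :: "nat \<Rightarrow> nat \<Rightarrow> nat \<Rightarrow> circuit" where
  "margolus a b t =
    [rot_gate (pi / 8) t, CNOT b t, rot_gate (pi / 8) t, CNOT a t,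
     rot_gate (- pi / 8) t, CNOT b t, rot_gate (- pi / 8) t]"

definition toffoli_perm :: "nat \<Rightarrow> nat \<Rightarrow> nat \<Rightarrow> nat \<Rightarrow> nat" where
  "toffoli_perm a b t x = (if bit x a \<and> bit x b then flip_bit t x else x)"

text \<open>The sign falls on basis states that the permutation fixes, so the gate is its own
  inverse.\<close>

lemma run_margolus:
  assumes "a \<noteq> t" "b \<noteq> t"
  shows "run (margolus a b t) \<phi> x =
    (if bit x a \<and> \<not> bit x b \<and> bit x t then - 1 else 1) * \<phi> (toffoli_perm a b t x)"
proof -
  define c0 where "c0 = cos (pi / 8)"
  define s0 where "s0 = sin (pi / 8)"
  have ss0: "s0 * s0 = 1 - c0 * c0"
    unfolding c0_def s0_def by (simp add: sin_squared_eq flip: power2_eq_square)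
  \<comment> \<open>Sine and cosine agree at the double angle \<open>pi / 4\<close>, which ties
    \<open>c0 * s0\<close> to \<open>c0 * c0\<close>. Squaring then yields a quadratic equation for
    \<open>c0 * c0\<close>.\<close>
  have "c0 * c0 - s0 * s0 = 2 * s0 * c0"
    using cos_double[of "pi / 8"] sin_double[of "pi / 8"]
    by (simp add: cos_45 sin_45 c0_def s0_def power2_eq_square)
  then have cs0: "c0 * s0 = c0 * c0 - 1 / 2"
    by (simp add: ss0 mult.commute)
  have "(c0 * s0) * (c0 * s0) = (c0 * c0) * (s0 * s0)" by simp
  then have cccc0: "c0 * (c0 * (c0 * c0)) = c0 * c0 - 1 / 8"
    unfolding cs0 ss0 by (simp add: algebra_simps)
  define c where "c = complex_of_real (cos (pi / 8))"
  define s where "s = complex_of_real (sin (pi / 8))"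
  have ss: "s * s = 1 - c * c" and cs: "c * s = c * c - 1 / 2" and cccc: "c * (c * (c * c)) = c * c - 1 / 8"
    using arg_cong[OF ss0, of complex_of_real] arg_cong[OF cs0, of complex_of_real]
      arg_cong[OF cccc0, of complex_of_real] by (simp_all add: c_def s_def c0_def s0_def)
  \<comment> \<open>These rules bring every even polynomial in \<open>c\<close>, \<open>s\<close> of degree at most 4 into normal form.\<close>
  have norm: "s * (s * z) = z - c * (c * z)" "c * (s * z) = c * (c * z) - z / 2"
    "c * (c * (c * (c * z))) = c * (c * z) - z / 8" for z
    using arg_cong[OF ss, of "\<lambda>u. u * z"] arg_cong[OF cs, of "\<lambda>u. u * z"]
      arg_cong[OF cccc, of "\<lambda>u. u * z"] by (simp_all add: algebra_simps)
  note expand = margolus_def rot_gate_def toffoli_perm_def bit_upd bit_update_normal assms assms[symmetric]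
    c_def[symmetric] s_def[symmetric] sin_minus cos_minus
  show ?thesis
    by (cases "bit x a"; cases "bit x b"; cases "bit x t"; simp add: expand)
       (simp_all add: algebra_simps norm)
qed

definition omega8 :: complex where
  "omega8 = cis (pi / 4)"

lemma norm_omega8 [simp]: "cmod omega8 = 1"
  by (simp add: omega8_def)

text \<open>The standard Toffoli circuit: \<open>phase_gate omega8\<close> is the T gate and
  \<open>phase_gate (cnj omega8)\<close> its inverse. Unlike \<open>margolus\<close> it is
  exact.\<close>

definition ccx :: "nat \<Rightarrow> nat \<Rightarrow> nat \<Rightarrow> circuit" where
  "ccx a b t =
    [had_gate t, CNOT b t, phase_gate (cnj omega8) t, CNOT a t, phase_gate omega8 t, CNOT b t,
     phase_gate (cnj omega8) t, CNOT a t, phase_gate omega8 t, had_gate t,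
     phase_gate omega8 b, phase_gate omega8 a, CNOT a b, phase_gate (cnj omega8) b, CNOT a b]"

lemma run_ccx:
  assumes "a \<noteq> t" "b \<noteq> t" "a \<noteq> b"
  shows "run (ccx a b t) \<phi> x = \<phi> (toffoli_perm a b t x)"
proof -
  define w where "w = omega8"
  define h where "h = inv_sqrt2"
  have ww: "w * w = \<i>" "cnj w * cnj w = - \<i>" "w * cnj w = 1" "cnj w * w = 1"
    by (simp_all add: w_def omega8_def cis_mult cis_cnj)
  have norm: "w * (w * z) = \<i> * z" "cnj w * (cnj w * z) = - \<i> * z" "w * (cnj w * z) = z" "cnj w * (w * z) = z"
    "h * (h * z) = z / 2" for z
    using inv_sqrt2_mult by (simp_all flip: mult.assoc add: ww h_def)
  note expand = ccx_def had_gate_def toffoli_perm_def bit_upd bit_update_normal assms assms[symmetric]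
    w_def[symmetric] h_def[symmetric] norm
  show ?thesis
    by (cases "bit x a"; cases "bit x b"; cases "bit x t"; simp add: expand)
       (simp_all add: algebra_simps norm)
qed

section \<open>Conditional bit flips and their conjugation\<close>

text \<open>The bits of the mask \<open>m\<close> are the qubits to be flipped, and no phase may
  remain. Amplitudes are pulled back, so \<open>P\<close> is evaluated at the output index.\<close>

definition toggles :: "circuit \<Rightarrow> (nat \<Rightarrow> bool) \<Rightarrow> nat \<Rightarrow> bool" where
  "toggles gs P m \<longleftrightarrow> (\<forall>\<phi> x. run gs \<phi> x = \<phi> (if P x then xor x m else x))"

lemma toggles_ccx:
  assumes "a \<noteq> t" "b \<noteq> t" "a \<noteq> b"
  shows "toggles (ccx a b t) (\<lambda>x. bit x a \<and> bit x b) (2 ^ t)"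
proof -
  have "flip_bit t x = xor x (2 ^ t)" for x :: nat
    by (rule bit_eqI) (auto simp: bit_upd)
  then show ?thesis
    using assms by (simp add: toggles_def run_ccx toffoli_perm_def)
qed

text \<open>Two flips by the same mask cancel, hence the exclusive or. The later circuit is looked
  up first and may pass \<open>xor x m\<close> on to \<open>P\<close>; hence the invariance.\<close>

lemma toggles_append:
  assumes "toggles gs P m" "toggles hs Q m" "\<And>x. P (xor x m) = P x"
  shows "toggles (gs @ hs) (\<lambda>x. P x \<noteq> Q x) m"
  using assms by (simp add: toggles_def xor.assoc)

lemma toggles_x_conj:
  assumes "toggles gs P m" "\<not> bit m q"
  shows "toggles ([x_gate q] @ gs @ [x_gate q]) (P \<circ> flip_bit q) m"
proof -
  have "flip_bit q (xor (flip_bit q x) m) = xor x m" for x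
    using assms(2) by (auto intro!: bit_eqI simp: bit_upd)
  then show ?thesis
    using assms(1) by (simp add: toggles_def bit_update_normal)
qed

text \<open>The sign depends only on \<open>a\<close>, \<open>b\<close> and \<open>t\<close>. The
  mask misses these, and \<open>toffoli_perm\<close> alters \<open>t\<close> only where
  \<open>b\<close> is 1 and the sign is 1. So both gates contribute the same sign, and the product
  is 1.\<close>

lemma toggles_margolus_conj:
  assumes "toggles gs P m" "a \<noteq> t" "b \<noteq> t" "\<not> bit m a" "\<not> bit m b" "\<not> bit m t"
  shows "toggles (margolus a b t @ gs @ margolus a b t) (P \<circ> toffoli_perm a b t) m"
proof -
  have "toffoli_perm a b t (xor (toffoli_perm a b t x) m) = xor x m"
    "toffoli_perm a b t (toffoli_perm a b t x) = x" for x
    using assms(2-) by (auto intro!: bit_eqI simp: bit_upd toffoli_perm_def)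
  moreover have "bit (toffoli_perm a b t x) q = (bit x q \<noteq> (q = t \<and> bit x a \<and> bit x b))" for x q
    by (auto simp: bit_upd toffoli_perm_def)
  ultimately show ?thesis
    using assms by (auto simp: toggles_def run_margolus bit_upd)
qed

text \<open>Here the mask does contain the control: a flip of \<open>c\<close> between two CNOTs
  spreads to \<open>t\<close>. The condition has to ignore \<open>t\<close>, because the CNOTs
  change it.\<close>

lemma toggles_cnot_conj:
  assumes "toggles gs P m" "c \<noteq> t" "bit m c" "\<not> bit m t" "\<And>x. P (flip_bit t x) = P x"
  shows "toggles ([CNOT c t] @ gs @ [CNOT c t]) P (flip_bit t m)"
proof -
  define f where "f x = (if bit x c then flip_bit t x else x)" for x :: nat
  have gate: "apply_gate (CNOT c t) \<phi> = (\<lambda>x. \<phi> (f x))" for \<phi>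
    by (simp add: f_def fun_eq_iff)
  have "f (xor (f x) m) = xor x (flip_bit t m)" "f (f x) = x" for x
    unfolding f_def using assms(2-4) by (auto intro!: bit_eqI simp: bit_upd)
  moreover have "P (f x) = P x" for x
    using assms(5) by (simp add: f_def)
  ultimately show ?thesis
    using assms(1) by (simp add: toggles_def gate del: apply_gate.simps)
qed

text \<open>Filler that raises the CNOT count to a prescribed value.\<close>

lemma toggles_pad:
  assumes "toggles gs P m" "c \<noteq> t"
  shows "toggles (gs @ [CNOT c t, CNOT c t]) P m"
  using assms by (auto simp: toggles_def bit_upd bit_update_normal)

text \<open>
  The qubit \<open>w\<close> may be in any state: the two \<open>ccx\<close> gates toggle \<open>t\<close> under \<open>(w \<oplus> a b) c\<close> and \<open>w c\<close>, which
  amounts to \<open>a b c\<close>.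
\<close>

definition cccx :: "nat \<Rightarrow> nat \<Rightarrow> nat \<Rightarrow> nat \<Rightarrow> nat \<Rightarrow> circuit" where
  "cccx a b c w t = (margolus a b w @ ccx w c t @ margolus a b w) @ ccx w c t"

lemma toggles_cccx:
  assumes "distinct [a, b, c, w, t]"
  shows "toggles (cccx a b c w t) (\<lambda>x. bit x a \<and> bit x b \<and> bit x c) (2 ^ t)"
proof -
  let ?P = "\<lambda>x. bit x w \<and> bit x c"
  have 1: "toggles (ccx w c t) ?P (2 ^ t)"
    using assms by (intro toggles_ccx) auto
  then have "toggles (margolus a b w @ ccx w c t @ margolus a b w) (?P \<circ> toffoli_perm a b w) (2 ^ t)"
    using assms by (intro toggles_margolus_conj) (auto simp: bit_upd)
  then have "toggles (cccx a b c w t) (\<lambda>x. (?P \<circ> toffoli_perm a b w) x \<noteq> ?P x) (2 ^ t)"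
    unfolding cccx_def by (rule toggles_append[OF _ 1]) (use assms in \<open>auto simp: toffoli_perm_def bit_upd\<close>)
  moreover have "(\<lambda>x. (?P \<circ> toffoli_perm a b w) x \<noteq> ?P x) = (\<lambda>x. bit x a \<and> bit x b \<and> bit x c)"
    using assms by (auto simp: toffoli_perm_def bit_upd fun_eq_iff)
  ultimately show ?thesis by simp
qed

section \<open>Networks of AND nodes\<close>

text \<open>A node \<open>(z, u, v)\<close> adds the AND of \<open>u\<close> and \<open>v\<close> to \<open>z\<close> and then flips \<open>u\<close> and \<open>v\<close>.\<close>

type_synonym and_node = "nat \<times> nat \<times> nat"

fun node_circ :: "and_node \<Rightarrow> circuit" where
  "node_circ (z, u, v) = margolus u v z @ [x_gate u, x_gate v]"

fun node_circ_inv :: "and_node \<Rightarrow> circuit" where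
  "node_circ_inv (z, u, v) = [x_gate v, x_gate u] @ margolus u v z"

fun node_perm :: "and_node \<Rightarrow> nat \<Rightarrow> nat" where
  "node_perm (z, u, v) x = flip_bit v (flip_bit u (toffoli_perm u v z x))"

fun node_qubits :: "and_node \<Rightarrow> nat set" where
  "node_qubits (z, u, v) = {z, u, v}"

fun node_ok :: "and_node \<Rightarrow> bool" where
  "node_ok (z, u, v) \<longleftrightarrow> distinct [z, u, v]"

lemma bit_node_perm:
  "distinct [z, u, v] \<Longrightarrow> bit (node_perm (z, u, v) x) q \<longleftrightarrow>
     (if q = u \<or> q = v then \<not> bit x q else if q = z then bit x z \<noteq> (bit x u \<and> bit x v) else bit x q)"
  by (auto simp: bit_upd toffoli_perm_def)

lemma toggles_node_conj:
  assumes "toggles gs P m" "node_ok a" "\<And>q. q \<in> node_qubits a \<Longrightarrow> \<not> bit m q"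
  shows "toggles (node_circ a @ gs @ node_circ_inv a) (P \<circ> node_perm a) m"
proof (cases a)
  case (fields z u v)
  let ?gs = "[x_gate u] @ ([x_gate v] @ gs @ [x_gate v]) @ [x_gate u]"
  have "toggles ?gs (P \<circ> flip_bit v \<circ> flip_bit u) m"
    using assms by (intro toggles_x_conj) (auto simp: fields)
  then have "toggles (margolus u v z @ ?gs @ margolus u v z) (P \<circ> flip_bit v \<circ> flip_bit u \<circ> toffoli_perm u v z) m"
    using assms by (intro toggles_margolus_conj) (auto simp: fields)
  moreover have "P \<circ> flip_bit v \<circ> flip_bit u \<circ> toffoli_perm u v z = P \<circ> node_perm a"
    by (auto simp: fields fun_eq_iff)
  ultimately show ?thesis by (simp add: fields)
qed

definition net_circ :: "and_node list \<Rightarrow> circuit" where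
  "net_circ ns = concat (map node_circ ns)"

definition net_circ_inv :: "and_node list \<Rightarrow> circuit" where
  "net_circ_inv ns = concat (map node_circ_inv (rev ns))"

definition net_perm :: "and_node list \<Rightarrow> nat \<Rightarrow> nat" where
  "net_perm ns = fold node_perm ns"

lemma net_simps [simp]:
  "net_circ [] = []" "net_circ (a # ns) = node_circ a @ net_circ ns"
  "net_circ (ns @ ns') = net_circ ns @ net_circ ns'"
  "net_circ_inv [] = []" "net_circ_inv (a # ns) = net_circ_inv ns @ node_circ_inv a"
  "net_perm [] x = x" "net_perm (a # ns) x = net_perm ns (node_perm a x)"
  "net_perm (ns @ ns') x = net_perm ns' (net_perm ns x)"
  by (simp_all add: net_circ_def net_circ_inv_def net_perm_def)

definition net_ok :: "nat set \<Rightarrow> and_node list \<Rightarrow> bool" where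
  "net_ok D ns \<longleftrightarrow> (\<forall>a \<in> set ns. node_ok a \<and> node_qubits a \<subseteq> D)"

lemma net_ok_simps [simp]:
  "net_ok D []" "net_ok D (a # ns) \<longleftrightarrow> node_ok a \<and> node_qubits a \<subseteq> D \<and> net_ok D ns"
  "net_ok D (ns @ ns') \<longleftrightarrow> net_ok D ns \<and> net_ok D ns'"
  by (auto simp: net_ok_def)

lemma net_ok_mono: "net_ok D ns \<Longrightarrow> D \<subseteq> E \<Longrightarrow> net_ok E ns"
  by (auto simp: net_ok_def)

text \<open>Each node wraps one more conjugation around the circuit, the first node being the
  outermost. Nothing is assumed about the values of the scratch qubits: they influence only the
  condition.\<close>

lemma toggles_net_conj:
  assumes "toggles gs P m" "net_ok D ns" "\<And>q. q \<in> D \<Longrightarrow> \<not> bit m q"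
  shows "toggles (net_circ ns @ gs @ net_circ_inv ns) (P \<circ> net_perm ns) m"
  using assms(2)
proof (induction ns)
  case Nil
  then show ?case using assms(1) by (simp add: comp_def)
next
  case (Cons a ns)
  then have IH: "toggles (net_circ ns @ gs @ net_circ_inv ns) (P \<circ> net_perm ns) m"
    by (simp only: net_ok_simps)
  have "toggles (node_circ a @ (net_circ ns @ gs @ net_circ_inv ns) @ node_circ_inv a)
      ((P \<circ> net_perm ns) \<circ> node_perm a) m"
    using Cons.prems assms(3) by (intro toggles_node_conj IH) auto
  then show ?case by (simp add: comp_def)
qed

lemma bit_net_perm_other:
  assumes "net_ok D ns" "q \<notin> D"
  shows "bit (net_perm ns x) q = bit x q"
  using assms(1)
proof (induction ns arbitrary: x)
  case (Cons a ns)
  obtain z u v where "a = (z, u, v)" by (cases a)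
  then show ?case using Cons assms(2) by (auto simp del: node_perm.simps simp: bit_node_perm)
qed simp

text \<open>Serves to make the final condition insensitive to the targets outside the network, as
  the fan-out requires.\<close>

lemma net_perm_flip_other:
  assumes "net_ok D ns" "q \<notin> D"
  shows "net_perm ns (flip_bit q x) = flip_bit q (net_perm ns x)"
  using assms(1)
proof (induction ns arbitrary: x)
  case (Cons a ns)
  obtain z u v where a: "a = (z, u, v)" by (cases a)
  have "node_perm a (flip_bit q x) = flip_bit q (node_perm a x)"
    using Cons.prems assms(2) unfolding a
    by (intro bit_eqI) (auto simp del: node_perm.simps simp: bit_node_perm bit_upd)
  then show ?case using Cons by simp
qed simp

section \<open>Depth, gate count and validity\<close>

text \<open>Witness form of a depth bound: layerings can be shifted, merged and reversed, which the
  least number of layers does not offer directly.\<close>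

definition depth_le :: "circuit \<Rightarrow> nat \<Rightarrow> bool" where
  "depth_le gs d \<longleftrightarrow> (\<exists>l. layering gs d l)"

lemma depth_leI:
  assumes "\<And>i. i < length gs \<Longrightarrow> l i < d"
    "\<And>i j. i < j \<Longrightarrow> j < length gs \<Longrightarrow> gate_qubits (gs ! i) \<inter> gate_qubits (gs ! j) \<noteq> {} \<Longrightarrow> l i < l j"
  shows "depth_le gs d"
  unfolding depth_le_def layering_def by (rule exI[of _ l]) (use assms in blast)

lemma depth_leE:
  assumes "depth_le gs d"
  obtains l where "\<And>i. i < length gs \<Longrightarrow> l i < d"
    "\<And>i j. i < j \<Longrightarrow> j < length gs \<Longrightarrow> gate_qubits (gs ! i) \<inter> gate_qubits (gs ! j) \<noteq> {} \<Longrightarrow> l i < l j"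
  using assms unfolding depth_le_def layering_def by blast

lemma depth_le_imp_depth: "depth_le gs d \<Longrightarrow> depth gs \<le> d"
  unfolding depth_le_def depth_def by (rule Least_le)

lemma depth_le_mono:
  assumes "depth_le gs d" "d \<le> d'"
  shows "depth_le gs d'"
proof -
  obtain l where l: "\<And>i. i < length gs \<Longrightarrow> l i < d"
    "\<And>i j. i < j \<Longrightarrow> j < length gs \<Longrightarrow> gate_qubits (gs ! i) \<inter> gate_qubits (gs ! j) \<noteq> {} \<Longrightarrow> l i < l j"
    using assms(1) by (rule depth_leE) blast
  show ?thesis
    by (rule depth_leI[of _ l]) (use l assms(2) in \<open>auto intro: less_le_trans\<close>)
qed

lemma depth_le_length: "length gs \<le> d \<Longrightarrow> depth_le gs d"
  by (rule depth_leI[of _ id]) auto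

lemma depth_le_append:
  assumes "depth_le gs d" "depth_le hs e"
  shows "depth_le (gs @ hs) (d + e)"
proof -
  obtain l where l: "\<And>i. i < length gs \<Longrightarrow> l i < d"
    "\<And>i j. i < j \<Longrightarrow> j < length gs \<Longrightarrow> gate_qubits (gs ! i) \<inter> gate_qubits (gs ! j) \<noteq> {} \<Longrightarrow> l i < l j"
    using assms(1) by (rule depth_leE) blast
  obtain k where k: "\<And>i. i < length hs \<Longrightarrow> k i < e"
    "\<And>i j. i < j \<Longrightarrow> j < length hs \<Longrightarrow> gate_qubits (hs ! i) \<inter> gate_qubits (hs ! j) \<noteq> {} \<Longrightarrow> k i < k j"
    using assms(2) by (rule depth_leE) blast
  show ?thesis
    by (rule depth_leI[of _ "\<lambda>i. if i < length gs then l i else d + k (i - length gs)"])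
       (auto simp: nth_append l k trans_less_add1 split: if_splits)
qed

text \<open>Without a common qubit the two circuits may share their layers.\<close>

lemma depth_le_parallel:
  assumes "depth_le gs d" "depth_le hs d"
    "(\<Union>g \<in> set gs. gate_qubits g) \<inter> (\<Union>g \<in> set hs. gate_qubits g) = {}"
  shows "depth_le (gs @ hs) d"
proof -
  obtain l where l: "\<And>i. i < length gs \<Longrightarrow> l i < d"
    "\<And>i j. i < j \<Longrightarrow> j < length gs \<Longrightarrow> gate_qubits (gs ! i) \<inter> gate_qubits (gs ! j) \<noteq> {} \<Longrightarrow> l i < l j"
    using assms(1) by (rule depth_leE) blast
  obtain k where k: "\<And>i. i < length hs \<Longrightarrow> k i < d"
    "\<And>i j. i < j \<Longrightarrow> j < length hs \<Longrightarrow> gate_qubits (hs ! i) \<inter> gate_qubits (hs ! j) \<noteq> {} \<Longrightarrow> k i < k j"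
    using assms(2) by (rule depth_leE) blast
  have "gate_qubits (gs ! i) \<inter> gate_qubits (hs ! j) = {}" if "i < length gs" "j < length hs" for i j
    using that assms(3) nth_mem[OF that(1)] nth_mem[OF that(2)] by blast
  then show ?thesis
    by (intro depth_leI[of _ "\<lambda>i. if i < length gs then l i else k (i - length gs)"])
       (auto simp: nth_append l k split: if_splits)
qed

text \<open>The layers are read backwards. Only the qubit sets matter; this covers inverse networks,
  where gates at mirrored positions differ in their rotation angles.\<close>

lemma depth_le_rev:
  assumes "depth_le gs d" "map gate_qubits hs = rev (map gate_qubits gs)"
  shows "depth_le hs d"
proof -
  obtain l where l: "\<And>i. i < length gs \<Longrightarrow> l i < d"
    "\<And>i j. i < j \<Longrightarrow> j < length gs \<Longrightarrow> gate_qubits (gs ! i) \<inter> gate_qubits (gs ! j) \<noteq> {} \<Longrightarrow> l i < l j"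
    using assms(1) by (rule depth_leE) blast
  let ?n = "length gs"
  have len: "length hs = ?n"
    using assms(2) by (metis length_map length_rev)
  have nth: "gate_qubits (hs ! i) = gate_qubits (gs ! (?n - 1 - i))" if "i < ?n" for i
  proof -
    have "gate_qubits (hs ! i) = map gate_qubits hs ! i"
      using that len by simp
    also have "\<dots> = gate_qubits (gs ! (?n - 1 - i))"
      using that by (simp add: assms(2) rev_nth rev_map)
    finally show ?thesis .
  qed
  show ?thesis
  proof (rule depth_leI[of _ "\<lambda>i. d - 1 - l (?n - 1 - i)"])
    fix i assume "i < length hs"
    then have "l (?n - 1 - i) < d" using len by (intro l) auto
    then show "d - 1 - l (?n - 1 - i) < d" by auto
  next
    fix i j assume ij: "i < j" "j < length hs" "gate_qubits (hs ! i) \<inter> gate_qubits (hs ! j) \<noteq> {}"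
    then have "l (?n - 1 - j) < l (?n - 1 - i)"
      using len nth[of i] nth[of j] by (intro l(2)) auto
    moreover have "l (?n - 1 - i) < d" using ij len by (intro l) auto
    ultimately show "d - 1 - l (?n - 1 - i) < d - 1 - l (?n - 1 - j)" by simp
  qed
qed

lemma map_gate_qubits_node_circ_inv:
  "map gate_qubits (node_circ_inv a) = rev (map gate_qubits (node_circ a))"
  by (cases a) (simp add: margolus_def)

lemma map_gate_qubits_net_circ_inv:
  "map gate_qubits (net_circ_inv ns) = rev (map gate_qubits (net_circ ns))"
  by (induction ns) (simp_all add: map_gate_qubits_node_circ_inv)

lemma length_node_circ: "length (node_circ a) = 9"
  by (cases a) (simp add: margolus_def)

lemma gate_qubits_net_circ:
  assumes "net_ok D ns"
  shows "(\<Union>g \<in> set (net_circ ns). gate_qubits g) \<subseteq> D"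
  using assms
proof (induction ns)
  case (Cons a ns)
  obtain z u v where "a = (z, u, v)" by (cases a)
  then show ?case using Cons by (auto simp: margolus_def)
qed simp

section \<open>CNOT count and validity of the building blocks\<close>

lemma cnot_count_simps [simp]:
  "cnot_count [] = 0" "cnot_count (g # gs) = (if is_CNOT g then 1 else 0) + cnot_count gs"
  "cnot_count (gs @ hs) = cnot_count gs + cnot_count hs"
  by (simp_all add: cnot_count_def)

lemma cnot_count_blocks [simp]:
  "cnot_count (margolus a b t) = 3" "cnot_count (ccx a b t) = 6" "cnot_count (cccx a b c w t) = 18"
  by (simp_all add: margolus_def ccx_def cccx_def)

lemma cnot_count_net [simp]:
  "cnot_count (net_circ ns) = 3 * length ns" "cnot_count (net_circ_inv ns) = 3 * length ns"
proof -
  have "cnot_count (node_circ a) = 3" "cnot_count (node_circ_inv a) = 3" for a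
    by (cases a; simp)+
  then show "cnot_count (net_circ ns) = 3 * length ns" "cnot_count (net_circ_inv ns) = 3 * length ns"
    by (induction ns) simp_all
qed

lemma valid_circuit_simps [simp]:
  "valid_circuit N []" "valid_circuit N (g # gs) \<longleftrightarrow> valid_gate N g \<and> valid_circuit N gs"
  "valid_circuit N (gs @ hs) \<longleftrightarrow> valid_circuit N gs \<and> valid_circuit N hs"
  by (auto simp: valid_circuit_def)

lemma valid_blocks:
  "a < N \<Longrightarrow> b < N \<Longrightarrow> t < N \<Longrightarrow> a \<noteq> t \<Longrightarrow> b \<noteq> t \<Longrightarrow> valid_circuit N (margolus a b t)"
  "a < N \<Longrightarrow> b < N \<Longrightarrow> t < N \<Longrightarrow> distinct [a, b, t] \<Longrightarrow> valid_circuit N (ccx a b t)"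
  "a < N \<Longrightarrow> b < N \<Longrightarrow> c < N \<Longrightarrow> w < N \<Longrightarrow> t < N \<Longrightarrow> distinct [a, b, c, w, t] \<Longrightarrow>
     valid_circuit N (cccx a b c w t)"
  by (auto simp: margolus_def ccx_def cccx_def)

lemma valid_net:
  assumes "net_ok D ns" "\<And>q. q \<in> D \<Longrightarrow> q < N"
  shows "valid_circuit N (net_circ ns)" "valid_circuit N (net_circ_inv ns)"
proof -
  have "valid_circuit N (node_circ a) \<and> valid_circuit N (node_circ_inv a)"
    if "node_ok a" "node_qubits a \<subseteq> D" for a
    using that assms(2) by (cases a) (auto intro!: valid_blocks)
  then show "valid_circuit N (net_circ ns)" "valid_circuit N (net_circ_inv ns)"
    using assms(1) by (induction ns) auto
qed

section \<open>An AND network of logarithmic depth\<close>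

text \<open>The qubits \<open>qs\<close> are clean scratch space, and \<open>cs\<close> are the controls.\<close>

lemma and_net_exists:
  assumes "3 \<le> length qs" "distinct (qs @ cs)" "cs \<noteq> []" "length cs \<le> 2 ^ k"
  shows "\<exists>ns d. length ns + 1 = length cs \<and> d \<in> set (qs @ cs) \<and> net_ok (set (qs @ cs)) ns \<and>
    depth_le (net_circ ns) (9 * (13 * k + 3 * (7 - length qs) + 2)) \<and>
    (\<forall>x. (\<forall>q \<in> set qs. \<not> bit x q) \<longrightarrow> bit (net_perm ns x) d = (\<forall>c \<in> set cs. bit x c))"
  using assms
proof (induction "(length cs, 7 - length qs)" arbitrary: qs cs k rule: wf_induct[OF wf_lex_prod[OF wf_less_than wf_less_than], rule_format])
  \<comment> \<open>The depth bound counts nodes of 9 gates. Halving the controls lowers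
    \<open>k\<close> by 1 and has to pay for 4 absorptions of 3 nodes each and one merging node,
    hence \<open>13\<close>. The term \<open>3 * (7 - length qs)\<close> covers the absorptions
    still ahead, and \<open>2\<close> the base case.\<close>
  case (1 qs cs k)
  obtain z z' y Q where qs: "qs = z # z' # y # Q"
    using \<open>3 \<le> length qs\<close> by (cases qs; cases "tl qs"; cases "tl (tl qs)") auto
  have node_bit: "bit (node_perm (z, u, v) x) q \<longleftrightarrow>
     (if q = u \<or> q = v then \<not> bit x q else if q = z then bit x z \<noteq> (bit x u \<and> bit x v) else bit x q)"
    if "z \<noteq> u" "z \<noteq> v" "u \<noteq> v" for z u v x q
    using that by (simp add: bit_node_perm del: node_perm.simps)
  note [simp del] = node_perm.simps node_circ.simps
  show ?case
  proof (cases "length cs \<le> 3")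
    case True
    have seq: "depth_le (net_circ ns) (9 * (13 * k + 3 * (7 - length qs) + 2))" if "length ns \<le> 2" for ns
    proof (rule depth_le_length)
      have "length (net_circ ns) = 9 * length ns"
        by (induction ns) (simp_all add: length_node_circ)
      then show "length (net_circ ns) \<le> 9 * (13 * k + 3 * (7 - length qs) + 2)"
        using that by simp
    qed
    consider a where "cs = [a]" | a b where "cs = [a, b]" | a b c where "cs = [a, b, c]"
      using True \<open>cs \<noteq> []\<close> by (cases cs; cases "tl cs"; cases "tl (tl cs)") auto
    then show ?thesis
    proof cases
      case 1
      then show ?thesis
        by (intro exI[of _ "[]"] exI[of _ a] conjI seq) auto
    next
      case (2 a b)
      then show ?thesis using \<open>distinct (qs @ cs)\<close>
        by (intro exI[of _ "[(z, a, b)]"] exI[of _ z] conjI seq) (auto simp: qs node_bit)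
    next
      case (3 a b c)
      then show ?thesis using \<open>distinct (qs @ cs)\<close>
        by (intro exI[of _ "[(z, a, b), (z', z, c)]"] exI[of _ z'] conjI seq) (auto simp: qs node_bit)
    qed
  next
    case False
    note len = this
    show ?thesis
    proof (cases "length qs < 7")
      case True
      obtain c1 c2 c3 C where cs: "cs = c1 # c2 # c3 # C" and C: "C \<noteq> []"
        using False by (cases cs; cases "tl cs"; cases "tl (tl cs)"; cases "tl (tl (tl cs))") auto
      \<comment> \<open>Two nodes put the AND of \<open>c1\<close>, \<open>c2\<close>,
        \<open>c3\<close> into \<open>z'\<close>. If it is 1, these three and \<open>z\<close> all
        end in 0 and can serve as scratch. With \<open>z'\<close> and \<open>y\<close> set aside,
        the scratch space grows by one.\<close>
      let ?qs = "c1 # c2 # c3 # z # Q"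
      have "\<exists>ns d. length ns + 1 = length C \<and> d \<in> set (?qs @ C) \<and> net_ok (set (?qs @ C)) ns \<and>
        depth_le (net_circ ns) (9 * (13 * k + 3 * (7 - length ?qs) + 2)) \<and>
        (\<forall>x. (\<forall>q \<in> set ?qs. \<not> bit x q) \<longrightarrow> bit (net_perm ns x) d = (\<forall>c \<in> set C. bit x c))"
        using "1.prems" C by (intro "1.hyps") (auto simp: qs cs)
      then obtain ns d where ns: "length ns + 1 = length C" "d \<in> set (?qs @ C)" "net_ok (set (?qs @ C)) ns"
        "depth_le (net_circ ns) (9 * (13 * k + 3 * (7 - length ?qs) + 2))"
        "\<And>x. (\<forall>q \<in> set ?qs. \<not> bit x q) \<Longrightarrow> bit (net_perm ns x) d = (\<forall>c \<in> set C. bit x c)"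
        by blast
      let ?ns = "(z, c1, c2) # (z', z, c3) # ns @ [(y, z', d)]"
      have dist: "distinct [z, z', y, c1, c2, c3]" "z' \<notin> set (?qs @ C)" "y \<notin> set (?qs @ C)"
        "d \<noteq> z'" "d \<noteq> y" "set C \<inter> {z, z', y, c1, c2, c3} = {}"
        "set Q \<inter> {z, z', y, c1, c2, c3} = {}" "set C \<inter> set Q = {}"
        using \<open>distinct (qs @ cs)\<close> ns(2) by (auto simp: qs cs)
      have sem: "bit (net_perm ?ns x) y = (\<forall>c \<in> set cs. bit x c)" if clean: "\<forall>q \<in> set qs. \<not> bit x q" for x
      proof -
        define w where "w = node_perm (z', z, c3) (node_perm (z, c1, c2) x)"
        have w: "bit w q \<longleftrightarrow> (if q = c1 \<or> q = c2 \<or> q = c3 then \<not> bit x q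
            else if q = z then \<not> (bit x c1 \<and> bit x c2)
            else if q = z' then bit x c1 \<and> bit x c2 \<and> bit x c3 else bit x q)" for q
          using dist(1) clean by (auto simp: w_def node_bit qs)
        have keep: "bit (net_perm ns w) z' = bit w z'" "bit (net_perm ns w) y = bit w y"
            by (rule bit_net_perm_other[OF ns(3) dist(2)], rule bit_net_perm_other[OF ns(3) dist(3)])
        have "bit (net_perm ?ns x) y = (bit w z' \<and> bit (net_perm ns w) d)"
        proof -
          have ne: "y \<noteq> z'" "y \<noteq> d" "z' \<noteq> d" using dist by auto
          have "\<not> bit w y" using w[of y] clean dist(1) by (auto simp: qs)
          moreover have "net_perm ?ns x = node_perm (y, z', d) (net_perm ns w)"
            by (simp add: w_def)
          ultimately show ?thesis by (simp add: node_bit ne keep)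
        qed
        also have "\<dots> = (\<forall>c \<in> set cs. bit x c)"
        proof (cases "bit w z'")
          case True
          then have all: "bit x c1" "bit x c2" "bit x c3" using w[of z'] dist(1) by auto
          then have "\<forall>q \<in> set ?qs. \<not> bit w q"
            using clean dist by (auto simp: w qs)
          then have "bit (net_perm ns w) d = (\<forall>c \<in> set C. bit w c)" by (rule ns(5))
          also have "\<dots> = (\<forall>c \<in> set C. bit x c)"
            using dist(6) by (intro ball_cong refl) (auto simp: w)
          finally show ?thesis using True all by (simp add: cs)
        next
          \<comment> \<open>The scratch may now be dirty and \<open>d\<close> meaningless, but
            \<open>y\<close> stays 0, which is right because one of \<open>c1\<close>,
            \<open>c2\<close>, \<open>c3\<close> is 0.\<close>
          case False
          then show ?thesis using w[of z'] dist(1) by (auto simp: cs)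
        qed
        finally show ?thesis .
      qed
      have D: "depth_le ((node_circ (z, c1, c2) @ node_circ (z', z, c3)) @ net_circ ns @ node_circ (y, z', d))
          ((9 + 9) + (9 * (13 * k + 3 * (7 - length ?qs) + 2) + 9))"
        by (intro depth_le_append ns(4) depth_le_length) (simp_all add: length_node_circ)
      \<comment> \<open>Three more nodes cost 27 layers, which is what the middle term gives up when
        the scratch grows by one; since \<open>length qs < 7\<close>, the truncated subtraction
        really decreases.\<close>
      have le: "(9 + 9) + (9 * (13 * k + 3 * (7 - length ?qs) + 2) + 9) \<le> 9 * (13 * k + 3 * (7 - length qs) + 2)"
        using True by (simp add: qs)
      have "net_circ ?ns = (node_circ (z, c1, c2) @ node_circ (z', z, c3)) @ net_circ ns @ node_circ (y, z', d)"
        by simp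
      then have depth: "depth_le (net_circ ?ns) (9 * (13 * k + 3 * (7 - length qs) + 2))"
        using depth_le_mono[OF D le] by (simp only:)
      have "length ?ns + 1 = length cs \<and> y \<in> set (qs @ cs) \<and> net_ok (set (qs @ cs)) ?ns"
        using ns(1,2) dist net_ok_mono[OF ns(3), of "set (qs @ cs)"] by (auto simp: qs cs)
      then show ?thesis using depth sem by blast
    next
      case False
      obtain z2 z3 z4 z5 Q' where Q: "Q = z2 # z3 # z4 # z5 # Q'"
        using False by (cases Q; cases "tl Q"; cases "tl (tl Q)"; cases "tl (tl (tl Q))") (auto simp: qs)
      \<comment> \<open>Three clean qubits go to each half, and \<open>y\<close> receives the AND of
        the two results: seven in all.\<close>
      let ?q1 = "[z, z', z2]" and ?q2 = "[z3, z4, z5]"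
      define h where "h = length cs div 2"
      define C1 where "C1 = take h cs"
      define C2 where "C2 = drop h cs"
      have cs: "cs = C1 @ C2" by (simp add: C1_def C2_def)
      obtain k' where k: "k = Suc k'"
        using len "1.prems"(4) by (cases k) auto
      have lens: "C1 \<noteq> []" "C2 \<noteq> []" "length C1 \<le> 2 ^ k'" "length C2 \<le> 2 ^ k'"
        using len "1.prems"(4) by (auto simp: C1_def C2_def h_def k)
      have "\<exists>ns d. length ns + 1 = length C1 \<and> d \<in> set (?q1 @ C1) \<and> net_ok (set (?q1 @ C1)) ns \<and>
        depth_le (net_circ ns) (9 * (13 * k' + 3 * (7 - length ?q1) + 2)) \<and>
        (\<forall>x. (\<forall>q \<in> set ?q1. \<not> bit x q) \<longrightarrow> bit (net_perm ns x) d = (\<forall>c \<in> set C1. bit x c))"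
        using "1.prems" lens by (intro "1.hyps") (auto simp: qs Q cs)
      then obtain ns1 d1 where ns1: "length ns1 + 1 = length C1" "d1 \<in> set (?q1 @ C1)"
        "net_ok (set (?q1 @ C1)) ns1" "depth_le (net_circ ns1) (9 * (13 * k' + 3 * (7 - length ?q1) + 2))"
        "\<And>x. (\<forall>q \<in> set ?q1. \<not> bit x q) \<Longrightarrow> bit (net_perm ns1 x) d1 = (\<forall>c \<in> set C1. bit x c)"
        by blast
      have "\<exists>ns d. length ns + 1 = length C2 \<and> d \<in> set (?q2 @ C2) \<and> net_ok (set (?q2 @ C2)) ns \<and>
        depth_le (net_circ ns) (9 * (13 * k' + 3 * (7 - length ?q2) + 2)) \<and>
        (\<forall>x. (\<forall>q \<in> set ?q2. \<not> bit x q) \<longrightarrow> bit (net_perm ns x) d = (\<forall>c \<in> set C2. bit x c))"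
        using "1.prems" lens by (intro "1.hyps") (auto simp: qs Q cs)
      then obtain ns2 d2 where ns2: "length ns2 + 1 = length C2" "d2 \<in> set (?q2 @ C2)"
        "net_ok (set (?q2 @ C2)) ns2" "depth_le (net_circ ns2) (9 * (13 * k' + 3 * (7 - length ?q2) + 2))"
        "\<And>x. (\<forall>q \<in> set ?q2. \<not> bit x q) \<Longrightarrow> bit (net_perm ns2 x) d2 = (\<forall>c \<in> set C2. bit x c)"
        by blast
      have disj: "set (?q1 @ C1) \<inter> set (?q2 @ C2) = {}" "y \<notin> set (?q1 @ C1)" "y \<notin> set (?q2 @ C2)"
        using "1.prems"(2) by (auto simp: qs Q cs)
      have d: "d1 \<noteq> d2" "y \<noteq> d1" "y \<noteq> d2" "d1 \<notin> set (?q2 @ C2)"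
        using disj ns1(2) ns2(2) by blast+
      let ?ns = "ns1 @ ns2 @ [(y, d1, d2)]"
      have sem: "bit (net_perm ?ns x) y = (\<forall>c \<in> set cs. bit x c)" if clean: "\<forall>q \<in> set qs. \<not> bit x q" for x
      proof -
        define w where "w = net_perm ns1 x"
        have w: "bit w q = bit x q" if "q \<notin> set (?q1 @ C1)" for q
          unfolding w_def by (rule bit_net_perm_other[OF ns1(3) that])
        have v: "bit (net_perm ns2 w) q = bit w q" if "q \<notin> set (?q2 @ C2)" for q
          by (rule bit_net_perm_other[OF ns2(3) that])
        \<comment> \<open>The second network does not touch \<open>d1\<close>, so the first result
          survives until the merging node.\<close>
        have b1: "bit (net_perm ns2 w) d1 = (\<forall>c \<in> set C1. bit x c)"
          using ns1(5)[of x] v[OF d(4)] clean by (simp add: w_def qs Q)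
        have wx: "bit w q = bit x q" if "q \<in> set (?q2 @ C2)" for q
          using disj that by (intro w) blast
        have "bit (net_perm ns2 w) d2 = (\<forall>c \<in> set C2. bit w c)"
          using clean wx by (intro ns2(5)) (simp add: qs Q)
        also have "\<dots> = (\<forall>c \<in> set C2. bit x c)"
          using wx by (intro ball_cong refl) simp
        finally have b2: "bit (net_perm ns2 w) d2 = (\<forall>c \<in> set C2. bit x c)" .
        have "\<not> bit (net_perm ns2 w) y"
          unfolding v[OF disj(3)] w[OF disj(2)] using clean by (simp add: qs)
        then show ?thesis
          using d b1 b2 by (simp add: node_bit cs ball_Un flip: w_def)
      qed
      have "depth_le (net_circ ns1 @ net_circ ns2) (9 * (13 * k' + 14))"
      proof (rule depth_le_parallel)
        show "depth_le (net_circ ns1) (9 * (13 * k' + 14))" "depth_le (net_circ ns2) (9 * (13 * k' + 14))"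
          using ns1(4) ns2(4) by (simp_all add: add.commute)
      qed (use gate_qubits_net_circ[OF ns1(3)] gate_qubits_net_circ[OF ns2(3)] disj(1) in blast)
      then have D: "depth_le ((net_circ ns1 @ net_circ ns2) @ node_circ (y, d1, d2)) (9 * (13 * k' + 14) + 9)"
        by (rule depth_le_append[OF _ depth_le_length]) (simp add: length_node_circ)
      \<comment> \<open>Each half starts with three scratch qubits, hence
        \<open>14 = 3 * 4 + 2\<close>. The merging node makes it \<open>15 = 13 + 2\<close>, the
        bound at \<open>Suc k'\<close> with \<open>7 - length qs\<close> equal to 0.\<close>
      have le: "9 * (13 * k' + 14) + 9 \<le> 9 * (13 * k + 3 * (7 - length qs) + 2)"
        by (simp add: k)
      have "net_circ ?ns = (net_circ ns1 @ net_circ ns2) @ node_circ (y, d1, d2)"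
        by simp
      then have depth: "depth_le (net_circ ?ns) (9 * (13 * k + 3 * (7 - length qs) + 2))"
        using depth_le_mono[OF D le] by (simp only:)
      have "length ?ns + 1 = length cs \<and> y \<in> set (qs @ cs) \<and> net_ok (set (qs @ cs)) ?ns"
      proof -
        have "length ?ns + 1 = length cs" using ns1(1) ns2(1) by (simp add: cs)
        moreover have "net_ok (set (qs @ cs)) ns1" "net_ok (set (qs @ cs)) ns2"
          by (rule net_ok_mono[OF ns1(3)], force simp: qs Q cs) (rule net_ok_mono[OF ns2(3)], force simp: qs Q cs)
        moreover have "d1 \<in> set (qs @ cs)" "d2 \<in> set (qs @ cs)"
          using ns1(2) ns2(2) by (auto simp: qs Q cs)
        ultimately show ?thesis using d by (simp add: qs)
      qed
      then show ?thesis using depth sem by blast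
    qed
  qed
qed

section \<open>Fan-out to several targets\<close>

definition cnots :: "(nat \<times> nat) list \<Rightarrow> circuit" where
  "cnots = map (\<lambda>(c, t). CNOT c t)"

lemma cnots_simps [simp]:
  "cnots [] = []" "cnots (p # ps) = CNOT (fst p) (snd p) # cnots ps" "cnots (ps @ ps') = cnots ps @ cnots ps'"
  by (simp_all add: cnots_def split_beta)

lemma cnot_count_cnots [simp]: "cnot_count (cnots ps) = length ps"
  by (induction ps) simp_all

lemma map_gate_qubits_cnots_rev: "map gate_qubits (cnots (rev ps)) = rev (map gate_qubits (cnots ps))"
  by (simp add: cnots_def rev_map)

lemma bit_fold_flip_bit:
  "distinct ts \<Longrightarrow> bit (fold flip_bit ts m) q \<longleftrightarrow> bit (m::nat) q \<noteq> (q \<in> set ts)"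
  by (induction ts arbitrary: m) (auto simp: bit_upd)

text \<open>First \<open>s\<close> reaches one target \<open>a\<close>; then \<open>s\<close> and
  \<open>a\<close> serve half of the others each, in parallel. The claim ranges over all
  \<open>gs\<close> because the recursive parts are wrapped around circuits that are already
  conjugated.\<close>

lemma fanout_exists:
  assumes "distinct (s # ts)" "length ts < 2 ^ k"
  shows "\<exists>ps. length ps = length ts \<and>
    (\<forall>(c, t) \<in> set ps. c \<in> set (s # ts) \<and> t \<in> set ts \<and> c \<noteq> t) \<and> depth_le (cnots ps) k \<and>
    (\<forall>gs P m. toggles gs P m \<longrightarrow> bit m s \<longrightarrow>
       (\<forall>t \<in> set ts. \<not> bit m t \<and> (\<forall>x. P (flip_bit t x) = P x)) \<longrightarrow>
       toggles (cnots (rev ps) @ gs @ cnots ps) P (fold flip_bit ts m))"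
  using assms
proof (induction k arbitrary: s ts)
  case 0
  then show ?case by (intro exI[of _ "[]"]) (simp add: depth_le_length)
next
  case (Suc k)
  show ?case
  proof (cases ts)
    case Nil
    then show ?thesis by (intro exI[of _ "[]"]) (simp add: depth_le_length)
  next
    case (Cons a rest)
    define h where "h = length rest div 2"
    define t1 where "t1 = take h rest"
    define t2 where "t2 = drop h rest"
    have ts: "ts = a # t1 @ t2" by (simp add: Cons t1_def t2_def)
    \<comment> \<open>Fewer than \<open>2 ^ Suc k\<close> targets leave at most
      \<open>2 ^ Suc k - 2\<close> without \<open>a\<close>, so each half has fewer than
      \<open>2 ^ k\<close>.\<close>
    have lens: "length t1 < 2 ^ k" "length t2 < 2 ^ k"
      using Suc.prems(2) by (auto simp: Cons t1_def t2_def h_def)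
    have dist: "distinct (s # t1)" "distinct (a # t2)" using Suc.prems(1) by (auto simp: ts)
    obtain p1 where p1: "length p1 = length t1"
      "\<forall>(c, t) \<in> set p1. c \<in> set (s # t1) \<and> t \<in> set t1 \<and> c \<noteq> t" "depth_le (cnots p1) k"
      "\<And>gs P m. toggles gs P m \<Longrightarrow> bit m s \<Longrightarrow> (\<forall>t \<in> set t1. \<not> bit m t \<and> (\<forall>x. P (flip_bit t x) = P x)) \<Longrightarrow>
         toggles (cnots (rev p1) @ gs @ cnots p1) P (fold flip_bit t1 m)"
      using Suc.IH[OF dist(1) lens(1)] by blast
    obtain p2 where p2: "length p2 = length t2"
      "\<forall>(c, t) \<in> set p2. c \<in> set (a # t2) \<and> t \<in> set t2 \<and> c \<noteq> t" "depth_le (cnots p2) k"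
      "\<And>gs P m. toggles gs P m \<Longrightarrow> bit m a \<Longrightarrow> (\<forall>t \<in> set t2. \<not> bit m t \<and> (\<forall>x. P (flip_bit t x) = P x)) \<Longrightarrow>
         toggles (cnots (rev p2) @ gs @ cnots p2) P (fold flip_bit t2 m)"
      using Suc.IH[OF dist(2) lens(2)] by blast
    let ?ps = "(s, a) # p1 @ p2"
    have qubits: "(\<Union>g \<in> set (cnots p1). gate_qubits g) \<subseteq> set (s # t1)"
      "(\<Union>g \<in> set (cnots p2). gate_qubits g) \<subseteq> set (a # t2)"
      using p1(2) p2(2) by (fastforce simp: cnots_def)+
    have "set (s # t1) \<inter> set (a # t2) = {}" using Suc.prems(1) by (auto simp: ts)
    then have "depth_le (cnots p1 @ cnots p2) k"
      using qubits by (intro depth_le_parallel p1(3) p2(3)) blast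
    then have "depth_le ([CNOT s a] @ (cnots p1 @ cnots p2)) (1 + k)"
      by (intro depth_le_append[OF depth_le_length]) simp_all
    then have depth: "depth_le (cnots ?ps) (Suc k)" by simp
    have "toggles (cnots (rev ?ps) @ gs @ cnots ?ps) P (fold flip_bit ts m)"
      if tog: "toggles gs P m" and s: "bit m s"
        and inv: "\<forall>t \<in> set ts. \<not> bit m t \<and> (\<forall>x. P (flip_bit t x) = P x)" for gs P m
    proof -
      have "toggles ([CNOT s a] @ gs @ [CNOT s a]) P (flip_bit a m)"
        using Suc.prems(1) s inv by (intro toggles_cnot_conj tog) (auto simp: ts)
      then have "toggles (cnots (rev p1) @ ([CNOT s a] @ gs @ [CNOT s a]) @ cnots p1) P
          (fold flip_bit t1 (flip_bit a m))"
        using Suc.prems(1) s inv by (intro p1(4)) (auto simp: ts bit_upd)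
      then have "toggles (cnots (rev p2) @ (cnots (rev p1) @ ([CNOT s a] @ gs @ [CNOT s a]) @ cnots p1) @ cnots p2) P
          (fold flip_bit t2 (fold flip_bit t1 (flip_bit a m)))"
        using Suc.prems(1) s inv by (intro p2(4)) (auto simp: ts bit_upd bit_fold_flip_bit)
      then show ?thesis by (simp add: ts)
    qed
    moreover have "length ?ps = length ts" using p1(1) p2(1) by (simp add: ts)
    moreover have "\<forall>(c, t) \<in> set ?ps. c \<in> set (s # ts) \<and> t \<in> set ts \<and> c \<noteq> t"
      using p1(2) p2(2) Suc.prems(1) by (fastforce simp: ts)
    ultimately show ?thesis using depth by blast
  qed
qed

section \<open>The circuit\<close>

lemma length_blocks: "length (ccx a b t) = 15" "length (cccx a b c w t) = 44"
  by (simp_all add: cccx_def margolus_def ccx_def)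

text \<open>The condition \<open>P\<close> is prescribed only where the ancilla is 0, and its
  independence of the other targets prepares the fan-out. The general network needs a control beyond
  0 to 3, so \<open>n \<le> 4\<close> is treated separately.\<close>

lemma single_target_exists:
  assumes "1 \<le> n" "1 \<le> m" "n \<le> 2 ^ k"
  shows "\<exists>gs P. toggles gs P (2 ^ n) \<and> valid_circuit (n + m + 1) gs \<and> cnot_count gs = 6 * n \<and>
    depth_le gs (234 * k + 332) \<and> (\<forall>t \<in> {n + 1..<n + m}. \<forall>x. P (flip_bit t x) = P x) \<and>
    (\<forall>x. \<not> bit x (n + m) \<longrightarrow> P x = (\<forall>c < n. bit x c))"
proof -
  let ?A = "n + m"
  consider "n = 1" | "n = 2" | "n = 3" | "n = 4" | "5 \<le> n" using assms(1) by linarith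
  then show ?thesis
  proof cases
    case 1
    \<comment> \<open>The ancilla, flipped to 1, acts as a second control, so that exactly 6 CNOTs
      are spent.\<close>
    let ?gs = "[x_gate ?A] @ ccx ?A 0 n @ [x_gate ?A]"
    have "toggles ?gs ((\<lambda>x. bit x ?A \<and> bit x 0) \<circ> flip_bit ?A) (2 ^ n)"
      using assms by (intro toggles_x_conj toggles_ccx) (auto simp: bit_upd)
    then show ?thesis
      using assms 1
      by (intro exI[of _ ?gs] exI[of _ "(\<lambda>x. bit x ?A \<and> bit x 0) \<circ> flip_bit ?A"] conjI)
         (auto simp: bit_upd valid_blocks length_blocks intro!: depth_le_length)
  next
    case 2
    \<comment> \<open>Three cancelling pairs bring the count from 6 to 12.\<close>
    let ?gs = "((ccx 0 1 n @ [CNOT 0 n, CNOT 0 n]) @ [CNOT 0 n, CNOT 0 n]) @ [CNOT 0 n, CNOT 0 n]"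
    have "toggles ?gs (\<lambda>x. bit x 0 \<and> bit x 1) (2 ^ n)"
      using 2 by (intro toggles_pad toggles_ccx) auto
    moreover have "depth_le ?gs (234 * k + 332)"
      by (rule depth_le_length) (simp add: length_blocks)
    ultimately show ?thesis
      using assms 2
      by (intro exI[of _ ?gs] exI[of _ "\<lambda>x. bit x 0 \<and> bit x 1"] conjI)
         (auto simp: bit_upd valid_blocks less_2_cases_iff)
  next
    case 3
    let ?gs = "cccx 0 1 2 ?A n"
    have "toggles ?gs (\<lambda>x. bit x 0 \<and> bit x 1 \<and> bit x 2) (2 ^ n)"
      using assms 3 by (intro toggles_cccx) auto
    moreover have "(\<forall>c < n. bit x c) \<longleftrightarrow> bit x 0 \<and> bit x 1 \<and> bit x 2" for x :: nat
      using 3 by (auto simp: numeral_3_eq_3 less_Suc_eq numeral_2_eq_2)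
    ultimately show ?thesis
      using assms 3
      by (intro exI[of _ ?gs] exI[of _ "\<lambda>x. bit x 0 \<and> bit x 1 \<and> bit x 2"] conjI)
         (auto simp: bit_upd valid_blocks length_blocks intro!: depth_le_length)
  next
    case 4
    let ?ns = "[(?A, 0, 1)]"
    let ?P = "(\<lambda>x. bit x ?A \<and> bit x 2 \<and> bit x 3) \<circ> net_perm ?ns"
    \<comment> \<open>Qubit 0 has been absorbed into the ancilla and is borrowed as the work
      qubit.\<close>
    let ?gs = "net_circ ?ns @ cccx ?A 2 3 0 n @ net_circ_inv ?ns"
    have ok: "net_ok {?A, 0, 1} ?ns" using 4 by auto
    have tog: "toggles ?gs ?P (2 ^ n)"
    proof (rule toggles_net_conj[OF _ ok])
      show "toggles (cccx ?A 2 3 0 n) (\<lambda>x. bit x ?A \<and> bit x 2 \<and> bit x 3) (2 ^ n)"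
        using assms 4 by (intro toggles_cccx) auto
      fix q assume "q \<in> {?A, 0, 1}"
      then have "q \<noteq> n" using assms 4 by auto
      then show "\<not> bit ((2::nat) ^ n) q" by (simp add: bit_upd)
    qed
    have "depth_le ?gs (234 * k + 332)"
      by (rule depth_le_length) (simp add: length_blocks margolus_def)
    moreover have "valid_circuit (n + m + 1) ?gs"
      using assms 4 by (auto intro!: valid_blocks)
    moreover have "cnot_count ?gs = 6 * n" using 4 by simp
    moreover have "?P (flip_bit t x) = ?P x" if "t \<in> {n + 1..<n + m}" for t x
    proof -
      have "net_perm ?ns (flip_bit t x) = flip_bit t (net_perm ?ns x)"
        using that 4 by (intro net_perm_flip_other[OF ok]) auto
      then show ?thesis using that 4 by (simp add: bit_upd del: net_simps)
    qed
    moreover have "?P x = (\<forall>c < n. bit x c)" if "\<not> bit x ?A" for x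
    proof -
      have "(\<forall>c < n. bit x c) \<longleftrightarrow> bit x 0 \<and> bit x 1 \<and> bit x 2 \<and> bit x 3"
        using 4 by (auto simp: eval_nat_numeral less_Suc_eq)
      then show ?thesis using that 4 by (auto simp: bit_node_perm simp del: node_perm.simps)
    qed
    ultimately show ?thesis using tog by blast
  next
    case 5
    \<comment> \<open>If the ancilla becomes 1, qubits 0 and 1 are reset to 0, and 0 can take the
      AND of 2 and 3. If that is 1 as well, then 1, 2 and 3 are clean and serve as scratch for the
      controls from 4 on.\<close>
    let ?D = "set ([1, 2, 3] @ [4..<n])"
    have "\<exists>ns d. length ns + 1 = length [4..<n] \<and> d \<in> ?D \<and> net_ok ?D ns \<and>
      depth_le (net_circ ns) (9 * (13 * k + 3 * (7 - length [1, 2, 3 :: nat]) + 2)) \<and>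
      (\<forall>x. (\<forall>q \<in> set [1, 2, 3]. \<not> bit x q) \<longrightarrow> bit (net_perm ns x) d = (\<forall>c \<in> set [4..<n]. bit x c))"
      using assms 5 by (intro and_net_exists) auto
    then obtain ns d where ns: "length ns + 1 = length [4..<n]" "d \<in> ?D" "net_ok ?D ns"
      "depth_le (net_circ ns) (9 * (13 * k + 3 * (7 - length [1, 2, 3 :: nat]) + 2))"
      "\<And>x. (\<forall>q \<in> set [1, 2, 3]. \<not> bit x q) \<Longrightarrow> bit (net_perm ns x) d = (\<forall>c \<in> set [4..<n]. bit x c)"
      by blast
    have ns_depth: "depth_le (net_circ ns) (9 * (13 * k + 14))"
      using ns(4) by (simp add: add.commute)
    \<comment> \<open>A work qubit in any state will do; one of 1 and 2 differs from
      \<open>d\<close>.\<close>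
    define w where "w = (if d = 1 then 2 else 1 :: nat)"
    let ?ns = "(?A, 0, 1) # (0, 2, 3) # ns"
    let ?P = "(\<lambda>x. bit x ?A \<and> bit x 0 \<and> bit x d) \<circ> net_perm ?ns"
    let ?gs = "net_circ ?ns @ cccx ?A 0 d w n @ net_circ_inv ?ns"
    let ?E = "insert ?A {..<n}"
    have d: "0 < d" "d < n" using ns(2) 5 by auto
    have w: "w < n" "w \<noteq> d" "w \<noteq> 0" using 5 by (auto simp: w_def)
    have ok: "net_ok ?E ?ns"
    proof -
      have "?D \<subseteq> ?E" using 5 by auto
      then have "net_ok ?E ns" by (rule net_ok_mono[OF ns(3)])
      then show ?thesis using 5 by auto
    qed
    have tog: "toggles ?gs ?P (2 ^ n)"
      using assms 5 d w by (intro toggles_net_conj[OF _ ok] toggles_cccx) (auto simp: bit_upd)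
    have D: "depth_le (net_circ ?ns) (18 + 9 * (13 * k + 14))"
    proof -
      have "depth_le ((node_circ (?A, 0, 1) @ node_circ (0, 2, 3)) @ net_circ ns) (18 + 9 * (13 * k + 14))"
        by (intro depth_le_append ns_depth depth_le_length)
           (simp add: length_node_circ del: node_circ.simps)
      then show ?thesis by (simp only: net_simps append_assoc)
    qed
    \<comment> \<open>The network and its inverse are allotted \<open>117 * k + 144\<close> layers
      each, and \<open>cccx\<close> its length 44.\<close>
    have "depth_le ?gs ((18 + 9 * (13 * k + 14)) + (44 + (18 + 9 * (13 * k + 14))))"
      by (intro depth_le_append D depth_le_rev[OF D] map_gate_qubits_net_circ_inv depth_le_length)
         (simp add: length_blocks)
    then have depth: "depth_le ?gs (234 * k + 332)" by (rule depth_le_mono) simp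
    have val: "valid_circuit (n + m + 1) ?gs"
    proof -
      have "valid_circuit (n + m + 1) (net_circ ?ns)" "valid_circuit (n + m + 1) (net_circ_inv ?ns)"
        by (rule valid_net[OF ok]; auto)+
      moreover have "valid_circuit (n + m + 1) (cccx ?A 0 d w n)"
        using assms 5 d w by (intro valid_blocks) auto
      ultimately show ?thesis by (simp only: valid_circuit_simps)
    qed
    have cnt: "cnot_count ?gs = 6 * n" using ns(1) 5 by (simp del: net_simps)
    have inv: "?P (flip_bit t x) = ?P x" if "t \<in> {n + 1..<n + m}" for t x
    proof -
      have "net_perm ?ns (flip_bit t x) = flip_bit t (net_perm ?ns x)"
        using that by (intro net_perm_flip_other[OF ok]) auto
      then show ?thesis using that d by (simp add: bit_upd del: net_simps)
    qed
    have sem: "?P x = (\<forall>c < n. bit x c)" if clean: "\<not> bit x ?A" for x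
    proof -
      define v where "v = node_perm (0, 2, 3) (node_perm (?A, 0, 1) x)"
      have v: "bit v q \<longleftrightarrow> (if q = 1 \<or> q = 2 \<or> q = 3 then \<not> bit x q
          else if q = 0 then \<not> bit x 0 \<noteq> (bit x 2 \<and> bit x 3)
          else if q = ?A then bit x 0 \<and> bit x 1 else bit x q)" for q
        using clean 5 unfolding v_def by (subst bit_node_perm, simp)+ (auto simp: bit_node_perm simp del: node_perm.simps)
      have "bit (net_perm ns v) ?A = bit v ?A" "bit (net_perm ns v) 0 = bit v 0"
        by (rule bit_net_perm_other[OF ns(3)]; use 5 in simp)+
      then have P: "?P x \<longleftrightarrow> bit v ?A \<and> bit v 0 \<and> bit (net_perm ns v) d"
        by (simp add: v_def del: node_perm.simps)
      have all: "(\<forall>c < n. bit x c) \<longleftrightarrow> bit x 0 \<and> bit x 1 \<and> bit x 2 \<and> bit x 3 \<and> (\<forall>c \<in> set [4..<n]. bit x c)"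
      proof -
        have "c < n \<longleftrightarrow> c = 0 \<or> c = 1 \<or> c = 2 \<or> c = 3 \<or> c \<in> set [4..<n]" for c
          using 5 by auto
        then show ?thesis by metis
      qed
      show ?thesis
      proof (cases "bit v ?A \<and> bit v 0")
        case True
        then have x: "bit x 0" "bit x 1" "bit x 2" "bit x 3" using v[of ?A] v[of 0] 5 by auto
        then have "bit (net_perm ns v) d = (\<forall>c \<in> set [4..<n]. bit v c)"
          by (intro ns(5)) (auto simp: v)
        also have "\<dots> = (\<forall>c \<in> set [4..<n]. bit x c)"
          by (intro ball_cong refl) (auto simp: v)
        finally show ?thesis unfolding P all using True x by simp
      next
        \<comment> \<open>One of the controls 0 to 3 is then 0, so both sides are false whatever
          \<open>d\<close> holds.\<close>
        case False
        then show ?thesis unfolding P all using v[of ?A] v[of 0] 5 by auto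
      qed
    qed
    show ?thesis using tog val cnt depth inv sem by blast
  qed
qed

section \<open>From conditional flips to the matrix of the multi-target gate\<close>

lemma implements_toffoli:
  assumes valid: "valid_circuit (n + m + 1) gs" and tog: "toggles gs P (fold flip_bit [n..<n + m] 0)"
    and P: "\<And>x. \<not> bit x (n + m) \<Longrightarrow> P x = (\<forall>c < n. bit x c)"
  shows "implements_with_clean_ancilla (n + m) gs (toffoli_mat n m)"
proof -
  define N where "N = n + m"
  define M where "M = fold flip_bit [n..<N] (0::nat)"
  define f where "f x = (if \<forall>c < n. bit x c then fold flip_bit [n..<N] x else x)" for x :: nat
  have M: "bit M q \<longleftrightarrow> n \<le> q \<and> q < N" for q
    by (simp add: M_def bit_fold_flip_bit)
  have bit_f: "bit (f x) q \<longleftrightarrow> bit x q \<noteq> ((\<forall>c < n. bit x c) \<and> n \<le> q \<and> q < N)" for x q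
    by (auto simp: f_def bit_fold_flip_bit)
  have ff: "f (f x) = x" for x
  proof -
    have "(\<forall>c < n. bit (f x) c) = (\<forall>c < n. bit x c)"
      by (auto simp: bit_f)
    then have "bit (f (f x)) q = bit x q" for q
      unfolding bit_f[of "f x"] bit_f[of x] by blast
    then show ?thesis by (rule bit_eqI)
  qed
  have f_lt: "f x < 2 ^ N \<longleftrightarrow> x < 2 ^ N" for x
    unfolding nat_less_exp_iff_bit by (auto simp: bit_f)
  have xor_lt: "xor x M < 2 ^ N \<longleftrightarrow> x < 2 ^ N" for x
    unfolding nat_less_exp_iff_bit by (auto simp: bit_upd M)
  have "circuit_mat (N + 1) gs *\<^sub>v tensor_vec \<psi> ket0 = tensor_vec (toffoli_mat n m *\<^sub>v \<psi>) ket0"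
    if "\<psi> \<in> carrier_vec (2 ^ N)" for \<psi>
  proof (rule eq_vecI)
    have car: "toffoli_mat n m \<in> carrier_mat (2 ^ N) (2 ^ N)"
      by (simp add: toffoli_mat_def basis_map_mat_def N_def)
    \<comment> \<open>The ancilla is the most significant qubit, so it is 0 exactly at the indices
      below \<open>2 ^ N\<close>.\<close>
    have tensor: "tensor_vec u ket0 $ x = (if x < 2 ^ N then u $ x else 0)"
      if "u \<in> carrier_vec (2 ^ N)" "x < 2 ^ (N + 1)" for u x
    proof (cases "x < 2 ^ N")
      case False
      then have "x div 2 ^ N = 1" using that(2) by (intro div_nat_eqI) auto
      then show ?thesis using that False by (simp add: tensor_vec_def ket0_def)
    qed (use that in \<open>simp add: tensor_vec_def ket0_def\<close>)
    have dims: "dim_vec (circuit_mat K hs *\<^sub>v u) = 2 ^ K" for K hs u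
    proof -
      have "dim_row (circuit_mat K hs) = 2 ^ K"
      proof (induction hs)
        case (Cons g hs)
        then show ?case by simp
      qed simp
      then show ?thesis by simp
    qed
    show "dim_vec (circuit_mat (N + 1) gs *\<^sub>v tensor_vec \<psi> ket0) =
        dim_vec (tensor_vec (toffoli_mat n m *\<^sub>v \<psi>) ket0)"
      unfolding dims using car by (simp add: tensor_vec_def ket0_def)
    fix x assume "x < dim_vec (tensor_vec (toffoli_mat n m *\<^sub>v \<psi>) ket0)"
    then have x: "x < 2 ^ (N + 1)" using car by (simp add: tensor_vec_def ket0_def)
    let ?\<phi> = "\<lambda>x. if x < 2 ^ N then \<psi> $ x else 0"
    have "(circuit_mat (N + 1) gs *\<^sub>v tensor_vec \<psi> ket0) $ x = run gs ?\<phi> x"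
      using valid that x tensor
      by (intro circuit_mat_apply) (auto simp: N_def tensor_vec_def ket0_def)
    also have "\<dots> = ?\<phi> (if P x then xor x M else x)"
      using tog by (simp add: toggles_def M_def N_def)
    \<comment> \<open>The mask misses the ancilla, so indices from \<open>2 ^ N\<close> on keep
      amplitude 0 whatever \<open>P\<close> says there; below, \<open>P\<close> is the AND of the
      controls.\<close>
    also have "\<dots> = (if x < 2 ^ N then \<psi> $ f x else 0)"
    proof (cases "x < 2 ^ N")
      case True
      then have "\<not> bit x N" unfolding nat_less_exp_iff_bit by simp
      then have "(if P x then xor x M else x) = f x"
        using P by (intro bit_eqI) (auto simp: bit_f bit_upd M N_def)
      then show ?thesis using True f_lt by simp
    qed (simp add: xor_lt)
    also have "\<dots> = tensor_vec (toffoli_mat n m *\<^sub>v \<psi>) ket0 $ x"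
    proof (cases "x < 2 ^ N")
      case True
      \<comment> \<open>Row \<open>x\<close> of the matrix has its only 1 in column
        \<open>f x\<close>, because \<open>f\<close> is its own inverse.\<close>
      have iff: "x = f y \<longleftrightarrow> y = f x" for y using ff by metis
      have "toffoli_mat n m = basis_map_mat N f"
        unfolding toffoli_mat_def f_def[abs_def] N_def by (rule refl)
      then have "(toffoli_mat n m *\<^sub>v \<psi>) $ x = (\<Sum>y<2^N. (if y = f x then 1 else 0) * \<psi> $ y)"
        using True that by (simp add: basis_map_mat_def scalar_prod_def atLeast0LessThan iff)
      also have "\<dots> = (\<Sum>y<2^N. if y = f x then \<psi> $ y else 0)"
        by (intro sum.cong) auto
      also have "\<dots> = \<psi> $ f x"
        using True f_lt by (subst sum.delta) auto
      finally show ?thesis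
        using True x car that by (subst tensor) (auto intro: mult_mat_vec_carrier)
    next
      case False
      then show ?thesis
        using x car that by (subst tensor) (auto intro: mult_mat_vec_carrier)
    qed
    finally show "(circuit_mat (N + 1) gs *\<^sub>v tensor_vec \<psi> ket0) $ x =
        tensor_vec (toffoli_mat n m *\<^sub>v \<psi>) ket0 $ x" .
  qed
  then show ?thesis
    using valid by (simp add: implements_with_clean_ancilla_def pure_state_def flip: N_def)
qed

section \<open>Logarithms and the final assembly\<close>

lemma ex_power_of_two_ge:
  assumes "1 \<le> n"
  shows "\<exists>k. n \<le> 2 ^ k \<and> real k \<le> 1 + 2 * ln (real n)"
proof (cases "n = 1")
  case True
  then show ?thesis by (intro exI[of _ 0]) simp
next
  case False
  then obtain j where j: "2 ^ j < n" "n \<le> 2 ^ (j + 1)"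
    using assms ex_power_ivl2[of 2 n] by auto
  have "real j * ln 2 = ln (real (2 ^ j))"
    by (simp add: ln_realpow)
  also have "\<dots> \<le> ln (real n)"
    using j(1) assms by (subst ln_le_cancel_iff) auto
  finally have "real j * ln 2 \<le> ln (real n)" .
  \<comment> \<open>The bound \<open>ln 2 \<ge> 1 / 2\<close> is \<open>ln y \<le> y - 1\<close> at
    \<open>y = 1 / 2\<close>; it gives the factor 2 in the claim.\<close>
  moreover have "real j * (1 / 2) \<le> real j * ln 2"
    using ln_le_minus_one[of "1 / 2 :: real"] by (intro mult_left_mono) (auto simp: ln_div)
  ultimately show ?thesis using j(2) by (intro exI[of _ "j + 1"]) auto
qed

theorem lemma1:
  shows "\<exists>C :: real. \<forall>n m :: nat. n \<ge> 1 \<and> m \<ge> 1 \<longrightarrow>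
    (\<exists>gs :: circuit.
       implements_with_clean_ancilla (n + m) gs (toffoli_mat n m) \<and>
       cnot_count gs = 6 * n + 2 * m \<and>
       real (depth gs) \<le> C * (1 + ln (real n) + ln (real m)))"
proof (intro exI[of _ 600] allI impI)
  fix n m :: nat
  assume "n \<ge> 1 \<and> m \<ge> 1"
  then have n: "1 \<le> n" and m: "1 \<le> m" by auto
  obtain k where k: "n \<le> 2 ^ k" "real k \<le> 1 + 2 * ln (real n)"
    using ex_power_of_two_ge[OF n] by blast
  obtain l where l: "m \<le> 2 ^ l" "real l \<le> 1 + 2 * ln (real m)"
    using ex_power_of_two_ge[OF m] by blast
  obtain gs P where gs: "toggles gs P (2 ^ n)" "valid_circuit (n + m + 1) gs" "cnot_count gs = 6 * n"
    "depth_le gs (234 * k + 332)" "\<And>t x. t \<in> {n + 1..<n + m} \<Longrightarrow> P (flip_bit t x) = P x"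
    "\<And>x. \<not> bit x (n + m) \<Longrightarrow> P x = (\<forall>c < n. bit x c)"
    using single_target_exists[OF n m k(1)] by blast
  \<comment> \<open>Target \<open>n\<close> is flipped by \<open>gs\<close> itself and is the source
    of the fan-out to the others.\<close>
  let ?ts = "[n + 1..<n + m]"
  have "distinct (n # ?ts)" "length ?ts < 2 ^ l" using l(1) m by auto
  from fanout_exists[OF this] obtain ps where ps: "length ps = length ?ts"
    "\<forall>(c, t) \<in> set ps. c \<in> set (n # ?ts) \<and> t \<in> set ?ts \<and> c \<noteq> t" "depth_le (cnots ps) l"
    "\<And>gs P M. toggles gs P M \<Longrightarrow> bit M n \<Longrightarrow> (\<forall>t \<in> set ?ts. \<not> bit M t \<and> (\<forall>x. P (flip_bit t x) = P x)) \<Longrightarrow>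
       toggles (cnots (rev ps) @ gs @ cnots ps) P (fold flip_bit ?ts M)"
    by blast
  \<comment> \<open>The fan-out and its inverse use \<open>2 * (m - 1)\<close> CNOTs; the cancelling
    pair supplies the missing two.\<close>
  let ?gs = "(cnots (rev ps) @ gs @ cnots ps) @ [CNOT 0 n, CNOT 0 n]"
  have "toggles (cnots (rev ps) @ gs @ cnots ps) P (fold flip_bit ?ts (2 ^ n))"
    using gs(5) by (intro ps(4) gs(1)) (auto simp: bit_upd)
  moreover have "fold flip_bit ?ts (2 ^ n) = fold flip_bit [n..<n + m] (0::nat)"
    using m by (simp add: upt_conv_Cons)
  ultimately have "toggles ?gs P (fold flip_bit [n..<n + m] 0)"
    using n by (intro toggles_pad) auto
  moreover have "valid_circuit (n + m + 1) ?gs"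
  proof -
    have "valid_circuit (n + m + 1) (cnots ps')" if "set ps' = set ps" for ps'
      using ps(2) that m by (fastforce simp: valid_circuit_def cnots_def)
    then show ?thesis using gs(2) n m by simp
  qed
  ultimately have "implements_with_clean_ancilla (n + m) ?gs (toffoli_mat n m)"
    using gs(6) by (intro implements_toffoli)
  moreover have "cnot_count ?gs = 6 * n + 2 * m"
    using gs(3) ps(1) m by simp
  moreover have "real (depth ?gs) \<le> 600 * (1 + ln (real n) + ln (real m))"
  proof -
    have "depth_le ?gs ((l + ((234 * k + 332) + l)) + 2)"
      by (intro depth_le_append gs(4) ps(3) depth_le_rev[OF ps(3)] map_gate_qubits_cnots_rev depth_le_length) simp
    then have "depth ?gs \<le> 234 * k + 2 * l + 334"
      by (intro order.trans[OF depth_le_imp_depth]) auto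
    then have "real (depth ?gs) \<le> 234 * real k + 2 * real l + 334"
      by (metis (mono_tags, lifting) of_nat_add of_nat_le_iff of_nat_mult of_nat_numeral)
    moreover have "0 \<le> ln (real n)" "0 \<le> ln (real m)" using n m by auto
    \<comment> \<open>Inserting the bounds on \<open>k\<close> and \<open>l\<close> gives at most
      \<open>570 + 468 * ln (real n) + 4 * ln (real m)\<close>, so 600 suffices.\<close>
    ultimately show ?thesis using k(2) l(2) by simp
  qed
  ultimately show "\<exists>gs. implements_with_clean_ancilla (n + m) gs (toffoli_mat n m) \<and>
      cnot_count gs = 6 * n + 2 * m \<and> real (depth gs) \<le> 600 * (1 + ln (real n) + ln (real m))"
    by blast
qed

end
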